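(* Let $F=\langle T_1,\dots,T_n\rangle$ be a polyfractal, i.e. the IFS fractal generated by a planar IFS $\mathcal{T}=\{T_1,\dots,T_n\}$. If $F$ has a finite number of extremal points, then all of them must be eventually periodic. If $F$ is irrational with respect to $\mathcal{T}$, then $F$ has no eventually periodic extremal points, and $F$ has at least a countably infinite number of extremal points.
   Context: IFS: $T_k(z)=p_k+\varphi_k(z-p_k)$ on $\mathbb{C}$, $k\in\mathcal{N}=\{1,\dots,n\}$, with $p_k\in\mathbb{C}$, $\varphi_k=\lambda_k e^{\vartheta_k i}$, $\lambda_k\in(0,1)$, rotation angle $\vartheta_k\in(-\pi,\pi]$. The IFS fractal $F$ is the unique nonempty compact set with $F=\bigcup_{k}T_k(F)$. Addresses: $\mathcal{A}_{fin}$ is the set of finite words over $\mathcal{N}$, including the empty word, written $0$, of length $|0|=0$; infinite addresses are elements of $\mathcal{N}^{\mathbb{N}}$. For finite $a$ of length $|a|$, $T_a=T_{a(1)}\circ\dots\circ T_{a(|a|)}$, $T_0=\mathrm{Id}$; for infinite $a$, $T_a$ denotes the point $\lim_m T_{a(1)}\circ\dots\circ T_{a(m)}(z)$, independent of $z$. For finite $b$, $b<a$ means $b$ is a prefix (truncation) of $a$ ($b=0$ allowed). For $x\in\mathcal{A}_{fin}\setminus\{0\}$, $p_x$ is the unique fixed point of $T_x$. For $f\in F$, $\mathrm{adr}(f)$ is the lexicographically smallest infinite address $a$ with $T_a=f$. The value of a finite address is $\nu(a)=\vartheta_{a(1)}+\dots+\vartheta_{a(|a|)} \bmod 2\pi\in[0,2\pi)$,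 $\nu(0)=0$. The set of periodic points is $\mathrm{Per}(F)=\{p_x:x\in\mathcal{A}_{fin}\setminus\{0\}\}$. A point $f\in F$ is eventually periodic (eventual) if $T_b^{-1}(f)\in\mathrm{Per}(F)$ for some finite $b<\mathrm{adr}(f)$. The set of focal points is $\mathrm{Foc}_{\mathcal{T}}(F)=\{p_x: x\in\mathcal{A}_{fin}\setminus\{0\},\ \nu(x)=0\}$. $F$ is irrational with respect to $\mathcal{T}$ if $\mathrm{Foc}_{\mathcal{T}}(F)=\varnothing$. The extremal points (extrema) of $F$ are the vertices (extreme points) of the convex hull of $F$.
   Formalization: The claims about irrational F assume that the fixed points p_1,…,p_n do not all coincide (F is not a single point); otherwise, e.g. n=1 and ϑ_1=1, F={p_1} is irrational but its only extremal point is periodic. *)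

theory Defs
  imports "HOL-Analysis.Analysis" "HOL-Library.Fun_Lexorder" "HOL-Library.Real_Mod"
begin

text \<open>
  The IFS is given by the sequences \<open>p\<close>, \<open>lam\<close>, \<open>theta\<close>; only the indices \<open>1, \<dots>, n\<close> matter.
\<close>

definition ifs_map ::
  "(nat \<Rightarrow> complex) \<Rightarrow> (nat \<Rightarrow> real) \<Rightarrow> (nat \<Rightarrow> real) \<Rightarrow> nat \<Rightarrow> complex \<Rightarrow> complex" where
  "ifs_map p lam theta k z = p k + rcis (lam k) (theta k) * (z - p k)"

definition ifs_fractal :: "nat \<Rightarrow> (nat \<Rightarrow> complex \<Rightarrow> complex) \<Rightarrow> complex set" where
  "ifs_fractal n T = (THE F. F \<noteq> {} \<and> compact F \<and> F = (\<Union>k\<in>{1..n}. T k ` F))"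

definition fin_addresses :: "nat \<Rightarrow> nat list set" where
  "fin_addresses n = lists {1..n}"

text \<open>An infinite address is indexed from \<open>0\<close>: its first letter is \<open>a 0\<close>.\<close>

definition inf_addresses :: "nat \<Rightarrow> (nat \<Rightarrow> nat) set" where
  "inf_addresses n = {a. range a \<subseteq> {1..n}}"

definition truncation :: "nat list \<Rightarrow> (nat \<Rightarrow> nat) \<Rightarrow> bool" where
  "truncation b a \<longleftrightarrow> (\<exists>m. b = map a [0..<m])"

text \<open>For a word \<open>[a\<^sub>1, \<dots>, a\<^sub>m]\<close>, the right fold is \<open>T a\<^sub>1 (\<dots> (T a\<^sub>m z))\<close>, the identity for \<open>[]\<close>.\<close>

definition word_map :: "(nat \<Rightarrow> complex \<Rightarrow> complex) \<Rightarrow> nat list \<Rightarrow> complex \<Rightarrow> complex" where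
  "word_map T a z = foldr T a z"

definition inf_point :: "(nat \<Rightarrow> complex \<Rightarrow> complex) \<Rightarrow> (nat \<Rightarrow> nat) \<Rightarrow> complex" where
  "inf_point T a = (THE w. \<forall>z. (\<lambda>m. word_map T (map a [0..<m]) z) \<longlonglongrightarrow> w)"

definition word_fixpoint :: "(nat \<Rightarrow> complex \<Rightarrow> complex) \<Rightarrow> nat list \<Rightarrow> complex" where
  "word_fixpoint T x = (THE z. word_map T x z = z)"

definition adr :: "nat \<Rightarrow> (nat \<Rightarrow> complex \<Rightarrow> complex) \<Rightarrow> complex \<Rightarrow> nat \<Rightarrow> nat" where
  "adr n T f = (THE a. a \<in> inf_addresses n \<and> inf_point T a = f \<and>
     (\<forall>a'\<in>inf_addresses n. inf_point T a' = f \<longrightarrow> a = a' \<or> less_fun a a'))"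

definition address_value :: "(nat \<Rightarrow> real) \<Rightarrow> nat list \<Rightarrow> real" where
  "address_value theta a = (\<Sum>k\<leftarrow>a. theta k) rmod (2 * pi)"

definition periodic_points :: "nat \<Rightarrow> (nat \<Rightarrow> complex \<Rightarrow> complex) \<Rightarrow> complex set" where
  "periodic_points n T = {word_fixpoint T x | x. x \<in> fin_addresses n - {[]}}"

definition eventually_periodic :: "nat \<Rightarrow> (nat \<Rightarrow> complex \<Rightarrow> complex) \<Rightarrow> complex \<Rightarrow> bool" where
  "eventually_periodic n T f \<longleftrightarrow> f \<in> ifs_fractal n T \<and>
     (\<exists>b. truncation b (adr n T f) \<and> inv (word_map T b) f \<in> periodic_points n T)"

definition focal_points ::
  "nat \<Rightarrow> (nat \<Rightarrow> complex \<Rightarrow> complex) \<Rightarrow> (nat \<Rightarrow> real) \<Rightarrow> complex set" where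
  "focal_points n T theta =
     {word_fixpoint T x | x. x \<in> fin_addresses n - {[]} \<and> address_value theta x = 0}"

definition irrational_ifs ::
  "nat \<Rightarrow> (nat \<Rightarrow> complex \<Rightarrow> complex) \<Rightarrow> (nat \<Rightarrow> real) \<Rightarrow> bool" where
  "irrational_ifs n T theta \<longleftrightarrow> focal_points n T theta = {}"

definition extremal_points :: "complex set \<Rightarrow> complex set" where
  "extremal_points F = {e. e extreme_point_of (convex hull F)}"

end

theory Submission
  imports Defs
begin

text \<open>
  Write \<open>f\<^sub>m = T\<^sub>b\<inverse>(f)\<close>, where \<open>b\<close> consists of the first \<open>m\<close> letters of the smallest
  address of \<open>f\<close>; these are the tails of \<open>f\<close>.  Everything rests on one observation: the maps
  are affine and injective and send \<open>F\<close> into itself, so a point of \<open>F\<close> whose image under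
  some \<open>T\<^sub>b\<close> is extremal must be extremal itself (\<open>extremal_preimage\<close>).  Hence all tails of an
  extremal point are extremal.

  If there are finitely many extremal points, the tails of one of them repeat.  From
  \<open>f\<^sub>i = f\<^sub>j\<close> with \<open>i < j\<close> it follows that \<open>f\<^sub>i\<close> is fixed by the word read between the positions
  \<open>i\<close> and \<open>j\<close>, so \<open>f\<^sub>i\<close> is periodic and \<open>f\<close> is eventually periodic
  (\<open>finite_extremal_eventually_periodic\<close>).

  Conversely, an eventually periodic extremal point has a tail that is at the same time extremal
  and the fixed point \<open>q\<close> of some \<open>T\<^sub>x\<close>.  About \<open>q\<close>, the map \<open>T\<^sub>x\<close> is a contraction combined
  with the rotation by \<open>w = cis (\<nu>(x))\<close>.  In the irrational case neither \<open>x\<close> nor \<open>x x\<close> has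
  value \<open>0\<close>, so \<open>w\<^sup>2 \<noteq> 1\<close>.  The orbit of any other point of \<open>F\<close> under \<open>T\<^sub>x\<close> spirals
  around \<open>q\<close> in the directions \<open>w\<^sup>m u\<close>, and these do not fit into a half-plane
  (\<open>rotation_leaves_half_plane\<close>), whereas the convex hull has a supporting line at the extreme
  point \<open>q\<close> (\<open>rotating_fixpoint_not_extremal\<close>).  So no extremal point is eventually periodic.
  Since a nonempty compact set does have extremal points, the finite case then shows that there
  are infinitely many.

  The fractal and the smallest address are definite descriptions, which have to be shown to be
  well defined first.  Existence of an invariant compact set comes from the nested images of a
  large disk; it is unique because it is the set of all points that have an address
  (\<open>invariant_eq_coded\<close>).  The smallest address of a point arises greedily, by always choosing the
  least possible next letter (\<open>adr_eq_greedy_address\<close>).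
\<close>

section \<open>Rotations leave every half-plane\<close>

text \<open>
  Let \<open>c\<^sub>m = Re (z w\<^sup>m)\<close>.  The sums of the \<open>c\<^sub>m\<close> are bounded, being real parts of geometric sums
  with ratio \<open>w \<noteq> 1\<close>.  The squares \<open>c\<^sub>m\<^sup>2 = (\<bar>z\<bar>\<^sup>2 + Re (z\<^sup>2 w\<^sup>2\<^sup>m)) / 2\<close> have the mean \<open>\<bar>z\<bar>\<^sup>2 / 2 > 0\<close>,
  because \<open>w\<^sup>2 \<noteq> 1\<close>.  If all \<open>c\<^sub>m\<close> were nonnegative, then \<open>c\<^sub>m\<^sup>2 \<le> \<bar>z\<bar> c\<^sub>m\<close> would bound the sums of
  the squares as well.
\<close>

lemma rotation_leaves_half_plane:
  fixes w z :: complex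
  assumes w: "norm w = 1" "w\<^sup>2 \<noteq> 1" and z: "z \<noteq> 0"
  shows "\<exists>m. Re (z * w ^ m) < 0"
proof (rule ccontr)
  assume "\<nexists>m. Re (z * w ^ m) < 0"
  then have nonneg: "Re (z * w ^ m) \<ge> 0" for m
    by (simp add: not_less)
  have bound: "\<bar>\<Sum>m<M. Re (y * v ^ m)\<bar> \<le> norm y * (2 / norm (v - 1))"
    if v: "norm v = 1" "v \<noteq> 1" for v y :: complex and M
  proof -
    have "(\<Sum>m<M. Re (y * v ^ m)) = Re (y * (\<Sum>m<M. v ^ m))"
      by (simp only: Re_sum sum_distrib_left)
    also have "\<dots> = Re (y * ((v ^ M - 1) / (v - 1)))"
      using geometric_sum[OF v(2), of M] by simp
    finally have "(\<Sum>m<M. Re (y * v ^ m)) = Re (y * ((v ^ M - 1) / (v - 1)))" .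
    also have "\<bar>Re (y * ((v ^ M - 1) / (v - 1)))\<bar> \<le> norm y * (norm (v ^ M - 1) / norm (v - 1))"
      by (metis abs_Re_le_cmod norm_divide norm_mult)
    also have "norm (v ^ M - 1) \<le> 2"
      using norm_triangle_ineq4[of "v ^ M" 1] v by (simp add: norm_power)
    finally show ?thesis
      by (simp add: divide_right_mono mult_left_mono)
  qed
  define A where "A = norm z * (2 / norm (w - 1))"
  define B where "B = norm (z\<^sup>2) * (2 / norm (w\<^sup>2 - 1))"
  have "w \<noteq> 1"
    using w by auto
  have sum1: "(\<Sum>m<M. Re (z * w ^ m)) \<le> A" for M
    using bound[OF w(1) \<open>w \<noteq> 1\<close>, of z M] by (simp add: A_def)
  have sum2: "- B \<le> (\<Sum>m<M. Re (z\<^sup>2 * (w\<^sup>2) ^ m))" for M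
    using bound[of "w\<^sup>2" "z\<^sup>2" M] w by (simp add: B_def norm_power abs_le_iff)
  have pointwise: "(norm z)\<^sup>2 + Re (z\<^sup>2 * (w\<^sup>2) ^ m) \<le> 2 * norm z * Re (z * w ^ m)" for m
  proof -
    define v where "v = z * w ^ m"
    have nv: "norm v = norm z"
      using w by (simp add: v_def norm_mult norm_power)
    have "z\<^sup>2 * (w\<^sup>2) ^ m = v\<^sup>2"
      by (simp add: v_def power_mult_distrib flip: power_mult) (simp add: mult.commute)
    moreover have "(norm v)\<^sup>2 + Re (v\<^sup>2) = 2 * (Re v * Re v)"
      by (simp add: cmod_power2) (simp add: power2_eq_square)
    moreover have "Re v * Re v \<le> norm v * Re v"
      using nonneg[of m] complex_Re_le_cmod[of v] by (simp add: v_def mult_right_mono)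
    ultimately show ?thesis
      by (simp add: nv flip: v_def)
  qed
  have "real M * (norm z)\<^sup>2 \<le> 2 * norm z * A + B" for M
  proof -
    have "real M * (norm z)\<^sup>2 - B \<le> (\<Sum>m<M. (norm z)\<^sup>2 + Re (z\<^sup>2 * (w\<^sup>2) ^ m))"
      using sum2[of M] by (simp add: sum.distrib)
    also have "\<dots> \<le> (\<Sum>m<M. 2 * norm z * Re (z * w ^ m))"
      by (intro sum_mono pointwise)
    also have "\<dots> = 2 * norm z * (\<Sum>m<M. Re (z * w ^ m))"
      by (simp only: sum_distrib_left)
    also have "\<dots> \<le> 2 * norm z * A"
      by (intro mult_left_mono sum1) simp
    finally show ?thesis by simp
  qed
  moreover obtain M :: nat where "2 * norm z * A + B < real M * (norm z)\<^sup>2"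
    using reals_Archimedean3[of "(norm z)\<^sup>2"] z by auto
  ultimately show False
    by (meson not_less)
qed

section \<open>The maps of words\<close>

locale planar_ifs =
  fixes n :: nat and p :: "nat \<Rightarrow> complex" and lam theta :: "nat \<Rightarrow> real"
  assumes n_pos: "1 \<le> n"
    and lam: "k \<in> {1..n} \<Longrightarrow> 0 < lam k \<and> lam k < 1"
begin

abbreviation T :: "nat \<Rightarrow> complex \<Rightarrow> complex" where
  "T \<equiv> ifs_map p lam theta"

definition word_factor :: "nat list \<Rightarrow> complex" where
  "word_factor w = (\<Prod>k\<leftarrow>w. rcis (lam k) (theta k))"

definition max_ratio :: real where
  "max_ratio = Max (lam ` {1..n})"

lemma max_ratio: "0 < max_ratio" "max_ratio < 1" "k \<in> {1..n} \<Longrightarrow> lam k \<le> max_ratio"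
proof -
  have ne: "lam ` {1..n} \<noteq> {}" and fin: "finite (lam ` {1..n})"
    using n_pos by auto
  have "max_ratio \<in> lam ` {1..n}"
    unfolding max_ratio_def by (rule Max_in[OF fin ne])
  then show "0 < max_ratio" "max_ratio < 1"
    using lam by auto
  show "k \<in> {1..n} \<Longrightarrow> lam k \<le> max_ratio"
    unfolding max_ratio_def using fin by auto
qed

lemma word_map_Nil [simp]: "word_map T [] z = z"
  by (simp add: word_map_def)

lemma word_map_Cons [simp]: "word_map T (k # w) z = T k (word_map T w z)"
  by (simp add: word_map_def)

lemma word_map_append: "word_map T (v @ w) z = word_map T v (word_map T w z)"
  by (simp add: word_map_def)

lemma word_map_diff: "word_map T w x - word_map T w y = word_factor w * (x - y)"
proof (induction w)
  case (Cons k w)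
  have "T k u - T k v = rcis (lam k) (theta k) * (u - v)" for u v
    by (simp add: ifs_map_def algebra_simps)
  then show ?case
    using Cons by (simp add: word_factor_def)
qed (simp add: word_factor_def)

lemma word_map_convex_comb:
  assumes "u + v = 1"
  shows "word_map T w (u *\<^sub>R x + v *\<^sub>R y) = u *\<^sub>R word_map T w x + v *\<^sub>R word_map T w y"
proof -
  have aff: "word_map T w z = word_map T w 0 + word_factor w * z" for z
    using word_map_diff[of w z 0] by (simp add: algebra_simps)
  have "word_map T w 0 = u *\<^sub>R word_map T w 0 + v *\<^sub>R word_map T w 0"
    using assms by (metis scaleR_left_distrib scaleR_one)
  then show ?thesis
    unfolding aff[of x] aff[of y] aff[of "u *\<^sub>R x + v *\<^sub>R y"] by (simp add: algebra_simps)
qed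

lemma word_factor_eq_rcis: "word_factor w = rcis (\<Prod>k\<leftarrow>w. lam k) (\<Sum>k\<leftarrow>w. theta k)"
  by (induction w) (simp_all add: word_factor_def rcis_mult)

lemma word_ratio_pos: "set w \<subseteq> {1..n} \<Longrightarrow> 0 < (\<Prod>k\<leftarrow>w. lam k)"
  using lam by (induction w) auto

lemma norm_word_factor_le: "set w \<subseteq> {1..n} \<Longrightarrow> norm (word_factor w) \<le> max_ratio ^ length w"
proof (induction w)
  case (Cons k w)
  have k: "0 < lam k" "lam k \<le> max_ratio"
    using Cons.prems lam max_ratio(3) by auto
  have "norm (word_factor (k # w)) = lam k * norm (word_factor w)"
    using k by (simp add: word_factor_def norm_mult)
  also have "\<dots> \<le> max_ratio * max_ratio ^ length w"
    using Cons k max_ratio(1) by (intro mult_mono) auto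
  finally show ?case by simp
qed (simp add: word_factor_def)

lemma word_factor_nonzero: "set w \<subseteq> {1..n} \<Longrightarrow> word_factor w \<noteq> 0"
  using word_ratio_pos[of w] by (simp add: word_factor_eq_rcis)

lemma word_factor_ne_1:
  assumes "set w \<subseteq> {1..n}" "w \<noteq> []"
  shows "word_factor w \<noteq> 1"
proof -
  have "max_ratio ^ length w < 1"
    using max_ratio assms(2) by (simp add: power_less_one_iff)
  then show ?thesis
    using norm_word_factor_le[OF assms(1)] by auto
qed

lemma bij_word_map: "set w \<subseteq> {1..n} \<Longrightarrow> bij (word_map T w)"
proof (rule bijI)
  assume w: "set w \<subseteq> {1..n}"
  note nz = word_factor_nonzero[OF w]
  show "inj (word_map T w)"
    using word_map_diff[of w] nz by (metis eq_iff_diff_eq_0 injI mult_eq_0_iff)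
  show "surj (word_map T w)"
  proof (rule surjI)
    fix y
    show "word_map T w ((y - word_map T w 0) / word_factor w) = y"
      using word_map_diff[of w "(y - word_map T w 0) / word_factor w" 0] nz by simp
  qed
qed

lemma inv_word_map [simp]: "set w \<subseteq> {1..n} \<Longrightarrow> inv (word_map T w) (word_map T w z) = z"
  using bij_word_map by (simp add: bij_is_inj)

lemma letter_in: "a \<in> inf_addresses n \<Longrightarrow> a m \<in> {1..n}"
  unfolding inf_addresses_def by blast

lemma set_map_address: "a \<in> inf_addresses n \<Longrightarrow> set (map a [0..<m]) \<subseteq> {1..n}"
  by (auto simp: inf_addresses_def)

lemma word_fixpoint_eqI:
  assumes "set w \<subseteq> {1..n}" "w \<noteq> []" "word_map T w z = z"
  shows "word_fixpoint T w = z"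
  unfolding word_fixpoint_def
proof (rule the_equality)
  fix y assume "word_map T w y = y"
  then have "y - z = word_factor w * (y - z)"
    using word_map_diff[of w y z] assms(3) by simp
  then show "y = z"
    using word_factor_ne_1[OF assms(1,2)] by (metis mult_cancel_right1 right_minus_eq)
qed fact

lemma word_fixpoint_fixed:
  assumes "set x \<subseteq> {1..n}" "x \<noteq> []"
  shows "word_map T x (word_fixpoint T x) = word_fixpoint T x"
proof -
  define z where "z = word_map T x 0 / (1 - word_factor x)"
  have "word_map T x z = z"
    using word_map_diff[of x z 0] word_factor_ne_1[OF assms] by (simp add: z_def field_simps)
  then show ?thesis
    using word_fixpoint_eqI[OF assms] by metis
qed

section \<open>The invariant set\<close>

definition invariant :: "complex set \<Rightarrow> bool" where
  "invariant K \<longleftrightarrow> K \<noteq> {} \<and> compact K \<and> K = (\<Union>k\<in>{1..n}. T k ` K)"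

lemma invariantD:
  assumes "invariant K"
  shows "K \<noteq> {}" "compact K" "bounded K" "(\<Union>k\<in>{1..n}. T k ` K) = K"
proof -
  show "K \<noteq> {}" "compact K" "(\<Union>k\<in>{1..n}. T k ` K) = K"
    using assms by (auto simp only: invariant_def)
  then show "bounded K"
    by (intro compact_imp_bounded)
qed

lemma continuous_on_T: "continuous_on A (T k)"
  unfolding ifs_map_def by (intro continuous_intros)

text \<open>
  The union of the maps sends a sufficiently large disk into itself.  Its iterated images are
  compact and decreasing, and their intersection is the invariant set.
\<close>

lemma ex_invariant: "\<exists>K. invariant K"
proof -
  define M where "M = Max ((\<lambda>k. norm (p k)) ` {1..n})"
  define R where "R = 2 * M / (1 - max_ratio)"
  define H where "H S = (\<Union>k\<in>{1..n}. T k ` S)" for S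
  \<comment> \<open>The image of the disk of radius \<open>R\<close> has norms at most \<open>2 M + max_ratio R\<close>, and \<open>R\<close>
    is chosen to make this equal to \<open>R\<close>.\<close>
  have M: "norm (p k) \<le> M" if "k \<in> {1..n}" for k
    unfolding M_def using that by (intro Max_ge) auto
  have M0: "0 \<le> M"
    using M[of 1] n_pos order_trans[OF norm_ge_zero] by simp
  have R: "0 \<le> R" "2 * M + max_ratio * R = R"
    using M0 max_ratio by (auto simp: R_def field_simps)
  have ball: "H (cball 0 R) \<subseteq> cball 0 R"
  proof -
    have "norm (T k z) \<le> R" if k: "k \<in> {1..n}" and z: "norm z \<le> R" for k z
    proof -
      have l: "0 < lam k" "lam k < 1" "lam k \<le> max_ratio"
        using lam[OF k] max_ratio(3)[OF k] by auto
      have "norm (T k z) \<le> norm (p k) + lam k * norm (z - p k)"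
        unfolding ifs_map_def using l
        by (intro order_trans[OF norm_triangle_ineq]) (simp add: norm_mult)
      also have "\<dots> \<le> norm (p k) + lam k * (norm z + norm (p k))"
        using l by (intro add_left_mono mult_left_mono norm_triangle_ineq4) auto
      also have "\<dots> = norm (p k) + lam k * norm z + lam k * norm (p k)"
        by (simp add: algebra_simps)
      also have "\<dots> \<le> M + max_ratio * R + 1 * M"
        using l z M[OF k] M0 max_ratio(1) by (intro add_mono mult_mono) auto
      finally show ?thesis
        using R by simp
    qed
    then show ?thesis
      by (auto simp: H_def)
  qed
  define B where "B m = (H ^^ m) (cball 0 R)" for m
  have B_Suc: "B (Suc m) = H (B m)" for m
    by (simp add: B_def)
  have H_mono: "H S \<subseteq> H S'" if "S \<subseteq> S'" for S S'
    using that by (auto simp: H_def)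
  have "B (Suc m) \<subseteq> B m" for m
  proof (induction m)
    case 0
    then show ?case using ball by (simp add: B_def)
  next
    case (Suc m)
    then show ?case by (metis B_Suc H_mono)
  qed
  then have anti: "B m \<subseteq> B l" if "l \<le> m" for l m
    using that lift_Suc_antimono_le[of B] by blast
  have comp: "compact (B m)" for m
    by (induction m)
      (auto simp: B_def H_def intro!: compact_UN compact_continuous_image continuous_on_T)
  have ne: "B m \<noteq> {}" for m
    using R n_pos by (induction m) (auto simp: B_def H_def)
  define K where "K = (\<Inter>m. B m)"
  have "K \<noteq> {}"
    unfolding K_def by (rule compact_nest[OF comp ne anti])
  moreover have "compact K"
    unfolding K_def by (intro compact_Inter) (use comp in auto)
  moreover have "K \<subseteq> H K"
  proof
    fix x assume "x \<in> K"
    then have "x \<in> H (B m)" for m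
      unfolding K_def B_Suc[symmetric] by blast
    then have "\<exists>k\<in>{1..n}. x \<in> T k ` B m" for m
      unfolding H_def by blast
    then obtain k where k: "\<And>m. k m \<in> {1..n}" "\<And>m. x \<in> T (k m) ` B m"
      by metis
    \<comment> \<open>The letter \<open>k m\<close> depends on \<open>m\<close>; one letter that occurs infinitely often serves all \<open>m\<close>,
      since the sets \<open>B m\<close> decrease.\<close>
    have "finite (range k)"
      by (rule finite_subset[of _ "{1..n}"]) (use k in auto)
    then obtain m0 where inf: "infinite {m. k m = k m0}"
      using pigeonhole_infinite[of UNIV k] by auto
    have inj: "inj (T (k m0))"
      using bij_word_map[of "[k m0]"] k(1)[of m0]
      by (simp add: bij_is_inj word_map_def[abs_def])
    obtain y where y: "x = T (k m0) y"
      using k(2)[of m0] by blast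
    have "y \<in> B m" for m
    proof -
      obtain j where j: "j > m" "k j = k m0"
        using inf unfolding infinite_nat_iff_unbounded by blast
      then have "y \<in> B j"
        using k(2)[of j] y inj by (metis imageE injD)
      then show ?thesis
        using anti[of m j] j by auto
    qed
    then have "y \<in> K"
      unfolding K_def by blast
    then show "x \<in> H K"
      unfolding H_def y using k(1) by blast
  qed
  moreover have "H K \<subseteq> K"
  proof -
    have "H K \<subseteq> B m" for m
    proof -
      have "H K \<subseteq> H (B m)"
        by (rule H_mono) (auto simp: K_def)
      also have "\<dots> \<subseteq> B m"
        using anti[of m "Suc m"] by (simp add: B_Suc)
      finally show ?thesis .
    qed
    then show ?thesis by (auto simp: K_def)
  qed
  ultimately show ?thesis
    unfolding invariant_def H_def by blast
qed

lemma word_map_invariant: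
  assumes "invariant K" "set w \<subseteq> {1..n}" "x \<in> K"
  shows "word_map T w x \<in> K"
  using assms(2)
proof (induction w)
  case (Cons k w)
  note invariantD(4)[OF assms(1)]
  moreover have "k \<in> {1..n}" "word_map T w x \<in> K"
    using Cons by auto
  ultimately show ?case
    unfolding word_map_Cons by blast
qed (use assms in auto)

section \<open>Addresses\<close>

text \<open>
  A point that lies in \<open>T\<^sub>b(K)\<close> for every truncation \<open>b\<close> of \<open>a\<close> has address \<open>a\<close>, because the
  diameters of these sets shrink to \<open>0\<close>.  All limits below are identified in this way.
\<close>

lemma word_map_tendsto:
  assumes "bounded K" "a \<in> inf_addresses n" "\<And>m. f \<in> word_map T (map a [0..<m]) ` K"
  shows "(\<lambda>m. word_map T (map a [0..<m]) z) \<longlonglongrightarrow> f"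
proof -
  obtain C where C: "\<And>y. y \<in> K \<Longrightarrow> norm (z - y) \<le> C"
    using assms(1) by (metis bounded_any_center dist_norm)
  have "norm (word_map T (map a [0..<m]) z - f) \<le> max_ratio ^ m * C" for m
  proof -
    obtain y where y: "y \<in> K" "f = word_map T (map a [0..<m]) y"
      using assms(3) by auto
    have "norm (word_factor (map a [0..<m])) \<le> max_ratio ^ m"
      using norm_word_factor_le[OF set_map_address[OF assms(2)], of m] by simp
    then show ?thesis
      unfolding y(2) word_map_diff norm_mult using C[OF y(1)] max_ratio(1)
      by (intro mult_mono) auto
  qed
  then have "\<forall>\<^sub>F m in sequentially. norm (word_map T (map a [0..<m]) z - f) \<le> max_ratio ^ m * C"
    by (intro always_eventually allI)
  moreover have "(\<lambda>m. max_ratio ^ m * C) \<longlonglongrightarrow> 0"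
    using max_ratio by (intro tendsto_mult_left_zero LIMSEQ_realpow_zero) auto
  ultimately have "(\<lambda>m. word_map T (map a [0..<m]) z - f) \<longlonglongrightarrow> 0"
    by (rule Lim_null_comparison)
  then show ?thesis
    by (simp add: LIM_zero_iff)
qed

lemma inf_point_eqI:
  assumes "bounded K" "a \<in> inf_addresses n" "\<And>m. f \<in> word_map T (map a [0..<m]) ` K"
  shows "inf_point T a = f"
  unfolding inf_point_def
proof (rule the_equality)
  show lim: "\<forall>z. (\<lambda>m. word_map T (map a [0..<m]) z) \<longlonglongrightarrow> f"
    using word_map_tendsto[OF assms] by blast
  show "w = f" if "\<forall>z. (\<lambda>m. word_map T (map a [0..<m]) z) \<longlonglongrightarrow> w" for w
    using that[rule_format, of 0] lim[rule_format, of 0] by (rule LIMSEQ_unique)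
qed

text \<open>
  The sets \<open>T\<^sub>b(K)\<close> for the truncations \<open>b\<close> of \<open>a\<close> are compact and nested, so they have a common
  point, which is the limit.  This shows that the limit exists for every address.
\<close>

lemma inf_point_in_cylinder:
  assumes K: "invariant K" and a: "a \<in> inf_addresses n"
  shows "inf_point T a \<in> word_map T (map a [0..<m]) ` K"
proof -
  define C where "C m = word_map T (map a [0..<m]) ` K" for m
  have cont: "continuous_on A (word_map T w)" for A w
  proof (induction w)
    case (Cons k w)
    have "word_map T (k # w) = T k \<circ> word_map T w"
      by (simp add: fun_eq_iff)
    then show ?case
      using Cons continuous_on_compose continuous_on_T by metis
  qed (simp add: word_map_def[abs_def])
  have "\<Inter>(range C) \<noteq> {}"
  proof (rule compact_nest)
    show "compact (C m)" for m
      unfolding C_def by (intro compact_continuous_image cont invariantD(2)[OF K])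
    show "C m \<noteq> {}" for m
      unfolding C_def using invariantD(1)[OF K] by simp
    have "C (Suc m) \<subseteq> C m" for m
      unfolding C_def
    proof safe
      fix x assume "x \<in> K"
      moreover have "a m \<in> {1..n}"
        by (rule letter_in[OF a])
      ultimately have "word_map T [a m] x \<in> K"
        by (intro word_map_invariant[OF K]) auto
      then show "word_map T (map a [0..<Suc m]) x \<in> word_map T (map a [0..<m]) ` K"
        by (simp add: word_map_append)
    qed
    then show "C m \<subseteq> C l" if "l \<le> m" for l m
      using that lift_Suc_antimono_le[of C] by blast
  qed
  then obtain f where f: "\<And>m. f \<in> C m"
    by auto
  have "inf_point T a = f"
    using f unfolding C_def by (rule inf_point_eqI[OF invariantD(3)[OF K] a])
  then show ?thesis
    using f[of m] by (simp add: C_def)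
qed

lemma inf_point_shift:
  assumes a: "a \<in> inf_addresses n"
  shows "inf_point T a = word_map T (map a [0..<m]) (inf_point T (\<lambda>i. a (m + i)))"
proof -
  obtain K where K: "invariant K"
    using ex_invariant by blast
  have shift: "(\<lambda>i. a (m + i)) \<in> inf_addresses n"
    using a by (auto simp: inf_addresses_def)
  define g where "g = inf_point T (\<lambda>i. a (m + i))"
  have "word_map T (map a [0..<m]) g \<in> word_map T (map a [0..<j]) ` K" for j
  proof (cases "j \<le> m")
    case True
    have split: "map a [0..<m] = map a [0..<j] @ map a [j..<m]"
      using upt_add_eq_append[of 0 j "m - j"] True by simp
    have "g \<in> K"
      using inf_point_in_cylinder[OF K shift, of 0] by (simp add: g_def)
    moreover have "set (map a [j..<m]) \<subseteq> {1..n}"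
      using a by (auto simp: inf_addresses_def)
    ultimately have "word_map T (map a [j..<m]) g \<in> K"
      by (intro word_map_invariant[OF K])
    then show ?thesis
      unfolding split word_map_append by (rule imageI)
  next
    case False
    then obtain i where i: "j = m + i"
      using le_Suc_ex[of m j] by auto
    have split: "map a [0..<j] = map a [0..<m] @ map (\<lambda>i. a (m + i)) [0..<i]"
      unfolding i by (rule nth_equalityI) (auto simp: nth_append)
    obtain y where "y \<in> K" "g = word_map T (map (\<lambda>i. a (m + i)) [0..<i]) y"
      using inf_point_in_cylinder[OF K shift, of i] unfolding g_def by blast
    then show ?thesis
      unfolding split word_map_append by blast
  qed
  then show ?thesis
    unfolding g_def[symmetric]
    by (rule inf_point_eqI[OF invariantD(3)[OF K] a])
qed

text \<open>
  The greedy address is defined for any set \<open>K\<close>, not only for the fractal, since the uniqueness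
  of the invariant set is itself derived from it.
\<close>

definition first_letter :: "complex set \<Rightarrow> complex \<Rightarrow> nat" where
  "first_letter K f = (LEAST k. k \<in> {1..n} \<and> f \<in> T k ` K)"

definition tail :: "complex set \<Rightarrow> complex \<Rightarrow> nat \<Rightarrow> complex" where
  "tail K f m = ((\<lambda>g. inv (T (first_letter K g)) g) ^^ m) f"

definition greedy_address :: "complex set \<Rightarrow> complex \<Rightarrow> nat \<Rightarrow> nat" where
  "greedy_address K f m = first_letter K (tail K f m)"

lemma first_letter:
  assumes "invariant K" "f \<in> K"
  shows "first_letter K f \<in> {1..n}" "inv (T (first_letter K f)) f \<in> K"
    "T (first_letter K f) (inv (T (first_letter K f)) f) = f"
proof -
  have "\<exists>k. k \<in> {1..n} \<and> f \<in> T k ` K"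
    using invariantD(4)[OF assms(1)] assms(2) by blast
  then have l: "first_letter K f \<in> {1..n} \<and> f \<in> T (first_letter K f) ` K"
    unfolding first_letter_def by (rule LeastI_ex)
  then show "first_letter K f \<in> {1..n}" by simp
  then have inj: "inj (T (first_letter K f))"
    using bij_word_map[of "[first_letter K f]"] by (simp add: bij_is_inj word_map_def[abs_def])
  obtain g where g: "f = T (first_letter K f) g" "g \<in> K"
    using l by blast
  then have "inv (T (first_letter K f)) f = g"
    using inv_f_eq[OF inj] by metis
  with g show "inv (T (first_letter K f)) f \<in> K" "T (first_letter K f) (inv (T (first_letter K f)) f) = f"
    by simp_all
qed

lemma tail_in: "invariant K \<Longrightarrow> f \<in> K \<Longrightarrow> tail K f m \<in> K"
  by (induction m) (auto simp: tail_def first_letter)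

lemma T_greedy_tail:
  "invariant K \<Longrightarrow> f \<in> K \<Longrightarrow> T (greedy_address K f m) (tail K f (Suc m)) = tail K f m"
  using first_letter(3)[OF _ tail_in] by (simp add: greedy_address_def tail_def)

lemma greedy_address_in: "invariant K \<Longrightarrow> f \<in> K \<Longrightarrow> greedy_address K f \<in> inf_addresses n"
  using first_letter(1)[OF _ tail_in] unfolding inf_addresses_def greedy_address_def by blast

lemma word_map_greedy_tail:
  assumes "invariant K" "f \<in> K"
  shows "i \<le> j \<Longrightarrow> word_map T (map (greedy_address K f) [i..<j]) (tail K f j) = tail K f i"
  by (induction j rule: dec_induct) (simp_all add: word_map_append T_greedy_tail[OF assms])

lemma word_map_greedy_tail_0:
  assumes "invariant K" "f \<in> K"
  shows "word_map T (map (greedy_address K f) [0..<m]) (tail K f m) = f"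
  using word_map_greedy_tail[OF assms, of 0 m] by (simp add: tail_def)

lemma inf_point_greedy_address:
  assumes "invariant K" "f \<in> K"
  shows "inf_point T (greedy_address K f) = f"
proof (rule inf_point_eqI[of K])
  show "bounded K"
    by (rule invariantD(3)[OF assms(1)])
  show "greedy_address K f \<in> inf_addresses n"
    by (rule greedy_address_in[OF assms])
  show "f \<in> word_map T (map (greedy_address K f) [0..<m]) ` K" for m
    using word_map_greedy_tail_0[OF assms, symmetric] tail_in[OF assms] by (rule image_eqI)
qed

lemma invariant_eq_coded:
  assumes "invariant K"
  shows "K = inf_point T ` inf_addresses n"
proof
  show "K \<subseteq> inf_point T ` inf_addresses n"
  proof
    fix f assume "f \<in> K"
    from imageI[OF greedy_address_in[OF assms this]] inf_point_greedy_address[OF assms this]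
    show "f \<in> inf_point T ` inf_addresses n"
      by metis
  qed
  show "inf_point T ` inf_addresses n \<subseteq> K"
    using inf_point_in_cylinder[OF assms, of _ 0] by (auto simp: image_iff)
qed

abbreviation F :: "complex set" where
  "F \<equiv> ifs_fractal n T"

lemma invariant_F: "invariant F"
proof -
  obtain K where "invariant K"
    using ex_invariant by blast
  moreover have "K' = K" if "invariant K'" for K'
    using invariant_eq_coded[OF that] invariant_eq_coded[OF \<open>invariant K\<close>] by (rule trans[OF _ sym])
  ultimately have "\<exists>!K. invariant K"
    by blast
  then have "invariant (THE K. invariant K)"
    by (rule theI')
  moreover have "F = (THE K. invariant K)"
    unfolding ifs_fractal_def invariant_def by (rule refl)
  ultimately show ?thesis
    by simp
qed

text \<open>
  At the first position \<open>i\<close> where another address of \<open>f\<close> differs from the greedy one, both still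
  describe the same tail of \<open>f\<close>, and the greedy letter is the least one whose map can produce it.
\<close>

lemma adr_eq_greedy_address:
  assumes f: "f \<in> F"
  shows "adr n T f = greedy_address F f"
proof -
  let ?g = "greedy_address F f"
  have min: "?g = a \<or> less_fun ?g a" if a: "a \<in> inf_addresses n" "inf_point T a = f" for a
  proof (cases "?g = a")
    case False
    define i where "i = (LEAST i. ?g i \<noteq> a i)"
    have i: "?g i \<noteq> a i"
      unfolding i_def by (rule LeastI_ex) (use False in auto)
    have eq: "?g j = a j" if "j < i" for j
      using that not_less_Least i_def by blast
    have "map ?g [0..<i] = map a [0..<i]"
      using eq by simp
    then have "word_map T (map a [0..<i]) (inf_point T (\<lambda>j. a (i + j))) =
        word_map T (map a [0..<i]) (tail F f i)"
      using inf_point_shift[OF a(1), of i] a(2) word_map_greedy_tail_0[OF invariant_F f, of i]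
      by (simp only:)
    then have tail: "tail F f i = inf_point T (\<lambda>j. a (i + j))"
      using inv_word_map[OF set_map_address[OF a(1)]] by metis
    have "(\<lambda>j. a (i + j)) \<in> inf_addresses n"
      using a by (auto simp: inf_addresses_def)
    from inf_point_in_cylinder[OF invariant_F this, of 1]
    have "tail F f i \<in> T (a i) ` F"
      by (auto simp: tail)
    moreover have "a i \<in> {1..n}"
      by (rule letter_in[OF a(1)])
    ultimately have "?g i \<le> a i"
      unfolding greedy_address_def first_letter_def by (intro Least_le) simp
    then show ?thesis
      using i eq by (intro disjI2 less_funI exI[of _ i]) auto
  qed simp
  show ?thesis
    unfolding adr_def
  proof (rule the_equality)
    show "?g \<in> inf_addresses n \<and> inf_point T ?g = f \<and>
        (\<forall>a'\<in>inf_addresses n. inf_point T a' = f \<longrightarrow> ?g = a' \<or> less_fun ?g a')"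
      using min greedy_address_in[OF invariant_F f] inf_point_greedy_address[OF invariant_F f]
      by blast
    then show "a = ?g" if "a \<in> inf_addresses n \<and> inf_point T a = f \<and>
        (\<forall>a'\<in>inf_addresses n. inf_point T a' = f \<longrightarrow> a = a' \<or> less_fun a a')" for a
      using that less_fun_asym by metis
  qed
qed

section \<open>Extremal points\<close>

lemma extremal_in_F: "e \<in> extremal_points F \<Longrightarrow> e \<in> F"
  using extreme_point_of_convex_hull by (auto simp: extremal_points_def)

text \<open>
  An affine injection maps a segment around \<open>y\<close> inside the convex hull to a segment around the
  image of \<open>y\<close>, which again lies in the convex hull because \<open>T\<^sub>w(F) \<subseteq> F\<close>.
\<close>

lemma extremal_preimage:
  assumes e: "word_map T w y \<in> extremal_points F" and w: "set w \<subseteq> {1..n}" and y: "y \<in> F"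
  shows "y \<in> extremal_points F"
proof -
  have hull: "word_map T w z \<in> convex hull F" if "z \<in> convex hull F" for z
  proof -
    have "convex {z. word_map T w z \<in> convex hull F}"
    proof (rule convexI)
      fix x y and u v :: real
      assume "x \<in> {z. word_map T w z \<in> convex hull F}" "y \<in> {z. word_map T w z \<in> convex hull F}"
        and uv: "0 \<le> u" "0 \<le> v" "u + v = 1"
      then show "u *\<^sub>R x + v *\<^sub>R y \<in> {z. word_map T w z \<in> convex hull F}"
        using convexD[OF convex_convex_hull _ _ uv] by (simp add: word_map_convex_comb[OF uv(3)])
    qed
    moreover have "F \<subseteq> {z. word_map T w z \<in> convex hull F}"
      using word_map_invariant[OF invariant_F w] by (auto intro: hull_inc)
    ultimately show ?thesis
      using that hull_minimal[of F _ convex] by blast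
  qed
  have "y \<notin> open_segment a b" if ab: "a \<in> convex hull F" "b \<in> convex hull F" for a b
  proof
    assume "y \<in> open_segment a b"
    then obtain u where u: "0 < u" "u < 1" "y = (1 - u) *\<^sub>R a + u *\<^sub>R b" and "a \<noteq> b"
      by (auto simp: in_segment)
    have "word_map T w a \<noteq> word_map T w b"
      using \<open>a \<noteq> b\<close> bij_word_map[OF w] by (metis bij_is_inj injD)
    moreover have "word_map T w y = (1 - u) *\<^sub>R word_map T w a + u *\<^sub>R word_map T w b"
      unfolding u(3) by (rule word_map_convex_comb) simp
    ultimately have "word_map T w y \<in> open_segment (word_map T w a) (word_map T w b)"
      using u by (auto simp: in_segment)
    then show False
      using e hull ab by (auto simp: extremal_points_def extreme_point_of_def)
  qed
  then show ?thesis
    using y by (auto simp: extremal_points_def extreme_point_of_def hull_inc)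
qed

lemma truncation_tail:
  assumes f: "f \<in> F" and b: "truncation b (adr n T f)"
  obtains m where "b = map (greedy_address F f) [0..<m]" "inv (word_map T b) f = tail F f m"
proof -
  obtain m where m: "b = map (greedy_address F f) [0..<m]"
    using b adr_eq_greedy_address[OF f] by (auto simp: truncation_def)
  have "inv (word_map T b) (word_map T b (tail F f m)) = tail F f m"
    unfolding m using set_map_address[OF greedy_address_in[OF invariant_F f]] by (rule inv_word_map)
  then show thesis
    using that m word_map_greedy_tail_0[OF invariant_F f, of m] by simp
qed

lemma extremal_tail:
  assumes "e \<in> extremal_points F"
  shows "tail F e m \<in> extremal_points F"
proof (rule extremal_preimage)
  have e: "e \<in> F"
    using assms by (rule extremal_in_F)
  show "word_map T (map (greedy_address F e) [0..<m]) (tail F e m) \<in> extremal_points F"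
    using assms word_map_greedy_tail_0[OF invariant_F e] by simp
  show "set (map (greedy_address F e) [0..<m]) \<subseteq> {1..n}"
    using greedy_address_in[OF invariant_F e] by (rule set_map_address)
  show "tail F e m \<in> F"
    by (rule tail_in[OF invariant_F e])
qed

lemma finite_extremal_eventually_periodic:
  assumes fin: "finite (extremal_points F)" and e: "e \<in> extremal_points F"
  shows "eventually_periodic n T e"
proof -
  note eF = extremal_in_F[OF e]
  let ?g = "greedy_address F e"
  have "range (tail F e) \<subseteq> extremal_points F"
    using extremal_tail[OF e] by auto
  then have "finite (range (tail F e))"
    using fin finite_subset by blast
  then have "\<not> inj (tail F e)"
    using finite_imageD by blast
  then obtain i j where ij: "i < j" "tail F e i = tail F e j"
    unfolding inj_def by (metis linorder_neq_iff)
  define x where "x = map ?g [i..<j]"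
  have x: "set x \<subseteq> {1..n}" "x \<noteq> []"
    using greedy_address_in[OF invariant_F eF] ij by (auto simp: x_def inf_addresses_def)
  have "word_map T x (tail F e i) = tail F e i"
    using word_map_greedy_tail[OF invariant_F eF, of i j] ij by (simp add: x_def)
  then have "word_fixpoint T x = tail F e i"
    by (rule word_fixpoint_eqI[OF x])
  then have per: "tail F e i \<in> periodic_points n T"
    unfolding periodic_points_def fin_addresses_def lists_eq_set using x
    by (intro CollectI exI[of _ x]) auto
  define b where "b = map ?g [0..<i]"
  have "inv (word_map T b) (word_map T b (tail F e i)) = tail F e i"
    unfolding b_def by (rule inv_word_map) (rule set_map_address[OF greedy_address_in[OF invariant_F eF]])
  then have "inv (word_map T b) e = tail F e i"
    using word_map_greedy_tail_0[OF invariant_F eF] by (simp add: b_def)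
  moreover have "truncation b (adr n T e)"
    using adr_eq_greedy_address[OF eF] by (auto simp: truncation_def b_def)
  ultimately show ?thesis
    unfolding eventually_periodic_def using eF per by auto
qed

text \<open>
  The centre of a map has a constant address.  In particular, \<open>F\<close> is not a single point if two
  centres differ.
\<close>

lemma fixed_centre_in_F:
  assumes "k \<in> {1..n}"
  shows "p k \<in> F"
proof -
  have "word_map T w (p k) = p k" if "set w \<subseteq> {k}" for w
    using that by (induction w) (auto simp: ifs_map_def)
  then have "word_map T (map (\<lambda>_. k) [0..<m]) (p k) = p k" for m
    by (simp add: image_subset_iff)
  then have "p k \<in> word_map T (map (\<lambda>_. k) [0..<m]) ` {p k}" for m
    by simp
  then have "inf_point T (\<lambda>_. k) = p k"
    by (intro inf_point_eqI[of "{p k}"]) (use assms in \<open>auto simp: inf_addresses_def\<close>)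
  moreover have "inf_point T (\<lambda>_. k) \<in> F"
    using inf_point_in_cylinder[OF invariant_F, of "\<lambda>_. k" 0] assms
    by (auto simp: inf_addresses_def)
  ultimately show ?thesis by simp
qed

text \<open>
  Irrationality is applied to the doubled word \<open>x x\<close>: this excludes the half turn as well as the
  trivial rotation.
\<close>

lemma irrational_square_rotation:
  assumes irr: "irrational_ifs n T theta" and x: "set x \<subseteq> {1..n}" "x \<noteq> []"
  shows "(cis (\<Sum>k\<leftarrow>x. theta k))\<^sup>2 \<noteq> 1"
proof
  assume "(cis (\<Sum>k\<leftarrow>x. theta k))\<^sup>2 = 1"
  then have "cis (\<Sum>k\<leftarrow>x @ x. theta k) = 1"
    by (simp add: power2_eq_square cis_mult)
  then have "cos (\<Sum>k\<leftarrow>x @ x. theta k) = 1"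
    by (metis cis.sel(1) one_complex.sel(1))
  then obtain N :: int where "(\<Sum>k\<leftarrow>x @ x. theta k) = of_int N * (2 * pi)"
    using cos_one_2pi_int by (metis mult.assoc)
  then have "address_value theta (x @ x) = 0"
    by (simp only: address_value_def rmod_self_multiple_int)
  then have "word_fixpoint T (x @ x) \<in> focal_points n T theta"
    unfolding focal_points_def fin_addresses_def lists_eq_set using x
    by (intro CollectI exI[of _ "x @ x"]) auto
  then show False
    using irr by (simp add: irrational_ifs_def)
qed

text \<open>
  The orbit of \<open>f\<close> would have to stay on one side of a supporting line at \<open>q\<close>.  The contraction
  does not change the side on which a point lies, so only the rotation matters.
\<close>

lemma rotating_fixpoint_not_extremal:
  assumes x: "set x \<subseteq> {1..n}" and rot: "(cis (\<Sum>k\<leftarrow>x. theta k))\<^sup>2 \<noteq> 1"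
    and q: "word_map T x q = q" and f: "f \<in> F" "f \<noteq> q"
  shows "q \<notin> extremal_points F"
proof
  assume "q \<in> extremal_points F"
  then have ext: "q extreme_point_of (convex hull F)"
    by (simp add: extremal_points_def)
  have "convex hull F \<noteq> {q}"
    using f hull_inc[of f F convex] by auto
  then have "q \<notin> rel_interior (convex hull F)"
    by (rule extreme_point_not_in_REL_INTERIOR[OF ext])
  moreover have "q \<in> closure (convex hull F)"
    using ext closure_subset by (auto simp: extreme_point_of_def)
  ultimately obtain a where a: "a \<noteq> 0" "\<And>y. y \<in> closure (convex hull F) \<Longrightarrow> a \<bullet> q \<le> a \<bullet> y"
    using supporting_hyperplane_relative_frontier[OF convex_convex_hull] by metis
  define r where "r = (\<Prod>k\<leftarrow>x. lam k)"
  define w where "w = cis (\<Sum>k\<leftarrow>x. theta k)"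
  have r: "r > 0"
    unfolding r_def by (rule word_ratio_pos[OF x])
  have factor: "word_factor x = of_real r * w"
    by (simp add: word_factor_eq_rcis rcis_def r_def w_def)
  have orbit: "(word_map T x ^^ m) f - q = (of_real r * w) ^ m * (f - q)" for m
  proof (induction m)
    case (Suc m)
    have "(word_map T x ^^ Suc m) f - q = word_map T x ((word_map T x ^^ m) f) - word_map T x q"
      by (simp add: q)
    then show ?case
      using Suc by (simp add: word_map_diff factor)
  qed simp
  have orbit_F: "(word_map T x ^^ m) f \<in> F" for m
    by (induction m) (use f word_map_invariant[OF invariant_F x] in auto)
  have "0 \<le> Re (cnj a * (f - q) * w ^ m)" for m
  proof -
    have "a \<bullet> q \<le> a \<bullet> (word_map T x ^^ m) f"
      by (intro a(2) subsetD[OF closure_subset] hull_inc orbit_F)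
    then have "0 \<le> a \<bullet> ((of_real r * w) ^ m * (f - q))"
      by (simp add: inner_diff_right flip: orbit)
    also have "(of_real r * w) ^ m * (f - q) = r ^ m *\<^sub>R (w ^ m * (f - q))"
      by (simp add: power_mult_distrib scaleR_conv_of_real mult.assoc)
    also have "a \<bullet> \<dots> = r ^ m * (a \<bullet> (w ^ m * (f - q)))"
      by (rule inner_scaleR_right)
    finally have "0 \<le> a \<bullet> (w ^ m * (f - q))"
      using zero_less_power[OF r, of m] by (metis zero_le_mult_iff not_less)
    also have "\<dots> = Re (cnj a * (w ^ m * (f - q)))"
      by (simp add: inner_complex_def)
    finally show ?thesis
      by (simp add: mult_ac)
  qed
  moreover have "\<exists>m. Re (cnj a * (f - q) * w ^ m) < 0"
    by (rule rotation_leaves_half_plane) (use rot a(1) f in \<open>auto simp: w_def\<close>)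
  ultimately show False
    by (meson not_less)
qed

lemma irrational_extremal_not_eventually_periodic:
  assumes irr: "irrational_ifs n T theta"
    and centres: "j \<in> {1..n}" "k \<in> {1..n}" "p j \<noteq> p k"
    and e: "e \<in> extremal_points F"
  shows "\<not> eventually_periodic n T e"
proof
  note eF = extremal_in_F[OF e]
  assume "eventually_periodic n T e"
  then obtain b x where b: "truncation b (adr n T e)"
    and inv: "inv (word_map T b) e = word_fixpoint T x" and x: "set x \<subseteq> {1..n}" "x \<noteq> []"
    unfolding eventually_periodic_def periodic_points_def fin_addresses_def by (auto simp: lists_eq_set)
  obtain m where "inv (word_map T b) e = tail F e m"
    using truncation_tail[OF eF b] by metis
  then have "word_fixpoint T x \<in> extremal_points F"
    using extremal_tail[OF e] inv by metis
  moreover obtain f where "f \<in> F" "f \<noteq> word_fixpoint T x"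
    using fixed_centre_in_F centres by metis
  ultimately show False
    using rotating_fixpoint_not_extremal[OF x(1) irrational_square_rotation[OF irr x]
        word_fixpoint_fixed[OF x]] by blast
qed

lemma extremal_points_nonempty: "extremal_points F \<noteq> {}"
proof -
  have "compact (convex hull F)" "convex hull F \<noteq> {}"
    using invariantD(1,2)[OF invariant_F] by (auto simp: compact_convex_hull)
  then obtain e where "e extreme_point_of (convex hull F)"
    using extreme_point_exists_convex convex_convex_hull by metis
  then show ?thesis
    by (auto simp: extremal_points_def)
qed

end

theorem theorem2p3:
  fixes n :: nat and p :: "nat \<Rightarrow> complex" and lam theta :: "nat \<Rightarrow> real"
    and T :: "nat \<Rightarrow> complex \<Rightarrow> complex" and F :: "complex set"
  assumes n: "1 \<le> n"
    and lam: "\<And>k. k \<in> {1..n} \<Longrightarrow> 0 < lam k \<and> lam k < 1"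
    and angle: "\<And>k. k \<in> {1..n} \<Longrightarrow> - pi < theta k \<and> theta k \<le> pi"
    and T: "T = ifs_map p lam theta"
    and F: "F = ifs_fractal n T"
  shows "(finite (extremal_points F) \<longrightarrow> (\<forall>e\<in>extremal_points F. eventually_periodic n T e)) \<and>
    ((\<exists>j\<in>{1..n}. \<exists>k\<in>{1..n}. p j \<noteq> p k) \<longrightarrow> irrational_ifs n T theta \<longrightarrow>
       (\<forall>e\<in>extremal_points F. \<not> eventually_periodic n T e) \<and> infinite (extremal_points F))"
proof -
  interpret planar_ifs n p lam theta
    by unfold_locales (use n lam in auto)
  have "\<forall>e\<in>extremal_points F. \<not> eventually_periodic n T e"
    if "\<exists>j\<in>{1..n}. \<exists>k\<in>{1..n}. p j \<noteq> p k" "irrational_ifs n T theta"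
    using that irrational_extremal_not_eventually_periodic unfolding F T by blast
  moreover have "\<forall>e\<in>extremal_points F. eventually_periodic n T e" if "finite (extremal_points F)"
    using that finite_extremal_eventually_periodic unfolding F T by blast
  moreover have "extremal_points F \<noteq> {}"
    using extremal_points_nonempty unfolding F T .
  ultimately show ?thesis
    by blast
qed

end
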